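(* Let $A\in\mathbb{R}^{n\times n}$ be stable. Then the optimization problem of minimizing $f(p) = -\log\det W_{\rm con}(p)$ subject to $p\in\mathcal{F} = X\cap\Delta$ has a unique solution; that is, there exists exactly one $p^*\in\mathcal{F}$ such that $f(p^* )\le f(p)$ for all $p\in\mathcal{F}$.
   Context: A real square matrix $A$ is called stable if all of its eigenvalues have negative real part. For stable $A\in\mathbb{R}^{n\times n}$ and $i=1,\dots,n$ put $W_i := \int_0^\infty \exp(At)\, e_i e_i^\top \exp(A^\top t)\, dt$, where $e_i\in\mathbb{R}^n$ is the $i$-th standard basis vector. For $p=(p_1,\dots,p_n)\in\mathbb{R}^n$ put $W_{\rm con}(p) := \sum_{i=1}^n p_i W_i$. Let $X := \{p\in\mathbb{R}^n \mid W_{\rm con}(p)\succ O\}$ (positive definite), $\Delta := \{p\in\mathbb{R}^n \mid \sum_{i=1}^n p_i = 1,\ p_i\ge 0 \ (i=1,\dots,n)\}$, and $\mathcal{F} := X\cap\Delta$. The function $f$ is defined on $X$ by $f(p) := -\log\det W_{\rm con}(p)$. *)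

theory Defs
  imports "HOL-Analysis.Analysis"
begin

definition complex_matrix :: "real ^ 'm ^ 'n \<Rightarrow> complex ^ 'm ^ 'n" where
  "complex_matrix A = (\<chi> i j. complex_of_real (A $ i $ j))"

definition eigenvalue :: "complex ^ 'n ^ 'n \<Rightarrow> complex \<Rightarrow> bool" where
  "eigenvalue A z \<longleftrightarrow> (\<exists>v. v \<noteq> 0 \<and> A *v v = z *s v)"

text \<open>The eigenvalues of a real matrix are taken over the complex numbers.\<close>

definition stable_matrix :: "real ^ 'n ^ 'n \<Rightarrow> bool" where
  "stable_matrix A \<longleftrightarrow> (\<forall>z. eigenvalue (complex_matrix A) z \<longrightarrow> Re z < 0)"

text \<open>The library multiplication \<open>(*)\<close>, and hence \<open>(^)\<close>, on the type of matrices is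
  entrywise, so the power with respect to the matrix product is defined separately.\<close>

primrec matrix_power :: "real ^ 'n ^ 'n \<Rightarrow> nat \<Rightarrow> real ^ 'n ^ 'n" where
  "matrix_power A 0 = mat 1"
| "matrix_power A (Suc k) = A ** matrix_power A k"

definition matrix_exp :: "real ^ 'n ^ 'n \<Rightarrow> real ^ 'n ^ 'n" where
  "matrix_exp A = (\<Sum>k. matrix_power A k /\<^sub>R fact k)"

definition W_single :: "real ^ 'n ^ 'n \<Rightarrow> 'n \<Rightarrow> real ^ 'n ^ 'n" where
  "W_single A i = integral {0..} (\<lambda>t::real.
     matrix_exp (t *\<^sub>R A) ** ((columnvector (axis i 1) :: real ^ 1 ^ 'n) ** rowvector (axis i 1))
       ** matrix_exp (t *\<^sub>R transpose A))"

definition W_con :: "real ^ 'n ^ 'n \<Rightarrow> real ^ 'n \<Rightarrow> real ^ 'n ^ 'n" where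
  "W_con A p = (\<Sum>i\<in>UNIV. (p $ i) *\<^sub>R W_single A i)"

definition positive_definite :: "real ^ 'n ^ 'n \<Rightarrow> bool" where
  "positive_definite M \<longleftrightarrow> transpose M = M \<and> (\<forall>x. x \<noteq> 0 \<longrightarrow> x \<bullet> (M *v x) > 0)"

definition X_set :: "real ^ 'n ^ 'n \<Rightarrow> (real ^ 'n) set" where
  "X_set A = {p. positive_definite (W_con A p)}"

definition Delta :: "(real ^ 'n) set" where
  "Delta = {p. (\<Sum>i\<in>UNIV. p $ i) = 1 \<and> (\<forall>i. p $ i \<ge> 0)}"

definition feasible :: "real ^ 'n ^ 'n \<Rightarrow> (real ^ 'n) set" where
  "feasible A = X_set A \<inter> Delta"

text \<open>Only the values on \<open>X_set A\<close> are meaningful; there the determinant is positive.\<close>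

definition objective :: "real ^ 'n ^ 'n \<Rightarrow> real ^ 'n \<Rightarrow> real" where
  "objective A p = - ln (det (W_con A p))"

end

theory Submission
  imports Defs "HOL-Computational_Algebra.Fundamental_Theorem_Algebra"
begin

text \<open>
  Minimising \<open>f\<close> amounts to maximising \<open>det W\<^sub>c\<^sub>o\<^sub>n\<close>, which is continuous on the compact simplex
  \<open>\<Delta>\<close>. On \<open>\<Delta>\<close> the matrix \<open>W\<^sub>c\<^sub>o\<^sub>n p\<close> is positive semidefinite, hence positive definite as soon as
  its determinant is nonzero; since it is positive definite at the barycentre, every maximiser is
  feasible. For uniqueness, stability gives the Lyapunov equation
  \<open>A W + W A\<^sup>T = - diag p\<close>, so \<open>W\<^sub>c\<^sub>o\<^sub>n\<close> is injective, and the midpoint of two distinct positive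
  definite matrices with equal determinants has a strictly larger determinant.
\<close>

section \<open>Determinants of positive definite matrices\<close>

lemma bounded_bilinear_matrix_mult:
  "bounded_bilinear ((**) :: real ^ 'n ^ 'm \<Rightarrow> real ^ 'p ^ 'n \<Rightarrow> real ^ 'p ^ 'm)"
  unfolding bilinear_conv_bounded_bilinear[symmetric] bilinear_def
  by (auto intro!: linearI simp: matrix_matrix_mult_def vec_eq_iff algebra_simps sum.distrib
      sum_distrib_left)

lemma symmetric_matrix_inner_swap:
  fixes M :: "real ^ 'n ^ 'n"
  assumes "transpose M = M"
  shows "x \<bullet> (M *v y) = y \<bullet> (M *v x)"
proof -
  have "x \<bullet> (M *v y) = (transpose M *v x) \<bullet> y" by (simp add: dot_lmul_matrix)
  then show ?thesis by (simp only: assms inner_commute)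
qed

lemma inner_transpose_matrix:
  fixes S :: "real ^ 'n ^ 'm"
  shows "x \<bullet> (transpose S *v y) = (S *v x) \<bullet> y"
  by (simp add: inner_commute[of x] inner_commute[of "S *v x"] dot_lmul_matrix)

text \<open>The nonnegative quadratic \<open>2 t a + t^2 b\<close> in \<open>t\<close> attains 0 at
  \<open>t = 0\<close>, so its slope there vanishes, and with it \<open>a\<close>. Thus a vector of
  \<open>V\<close> on which a semidefinite form is zero lies in the radical of that form.\<close>

lemma semidefinite_null_orthogonal:
  fixes M :: "real ^ 'n ^ 'n"
  assumes V: "subspace V" and sym: "transpose M = M"
    and psd: "\<And>y. y \<in> V \<Longrightarrow> 0 \<le> y \<bullet> (M *v y)"
    and x: "x \<in> V" "x \<bullet> (M *v x) = 0" and y: "y \<in> V"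
  shows "x \<bullet> (M *v y) = 0"
proof -
  define a b where "a = x \<bullet> (M *v y)" and "b = y \<bullet> (M *v y)"
  have b: "b \<ge> 0" using psd[OF y] by (simp add: b_def)
  have sw: "y \<bullet> (M *v x) = a"
    unfolding a_def by (rule symmetric_matrix_inner_swap[OF sym])
  have "0 \<le> 2 * t * a + t\<^sup>2 * b" for t
  proof -
    have "0 \<le> (x + t *\<^sub>R y) \<bullet> (M *v (x + t *\<^sub>R y))"
      using V x y by (intro psd subspace_add subspace_scale)
    also have "\<dots> = x \<bullet> (M *v x) + t * a + t * (y \<bullet> (M *v x)) + t * t * b"
      by (simp add: matrix_vector_right_distrib matrix_vector_mult_scaleR inner_add_left
          inner_add_right a_def b_def algebra_simps)
    finally show ?thesis using x sw by (simp add: power2_eq_square algebra_simps)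
  qed
  \<comment> \<open>The vertex \<open>- a / b\<close> would say nothing when \<open>b = 0\<close>;
    with \<open>b + 1\<close> the value is still negative unless \<open>a = 0\<close>.\<close>
  from this[of "- a / (b + 1)"] have "0 \<le> (2 * (- a / (b + 1)) * a + (- a / (b + 1))\<^sup>2 * b) * (b + 1)\<^sup>2"
    by simp
  also have "\<dots> = - (a\<^sup>2 * (b + 2))"
  proof -
    have "(2 * (- a / c) * a + (- a / c)\<^sup>2 * b) * c\<^sup>2 = a\<^sup>2 * b - 2 * a\<^sup>2 * c" if "c \<noteq> 0" for c
      using that by (simp add: field_simps power2_eq_square)
    from this[of "b + 1"] b show ?thesis by (simp add: algebra_simps)
  qed
  finally have "a\<^sup>2 * (b + 2) \<le> 0" by simp
  with b have "a\<^sup>2 \<le> 0" by (simp add: mult_le_0_iff)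
  then show ?thesis by (simp add: a_def)
qed

text \<open>Where the ratio of the two forms is maximal on \<open>V\<close>, the form \<open>r x P - Q\<close> is semidefinite and
  vanishes at \<open>x\<close>, so its radical contains \<open>x\<close>: \<open>P\<close>-orthogonality to \<open>x\<close> implies
  \<open>Q\<close>-orthogonality, and one recurses on the \<open>P\<close>-orthogonal complement of \<open>x\<close>.\<close>

lemma simultaneous_orthogonal_set:
  fixes P Q :: "real ^ 'n ^ 'n"
  assumes P: "positive_definite P" and Q: "transpose Q = Q"
  shows "subspace V \<Longrightarrow> k \<le> dim V \<Longrightarrow>
    \<exists>B. B \<subseteq> V \<and> finite B \<and> card B = k \<and> 0 \<notin> B \<and>
      pairwise (\<lambda>x y. x \<bullet> (P *v y) = 0 \<and> x \<bullet> (Q *v y) = 0) B"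
proof (induction k arbitrary: V)
  case 0
  then show ?case by (intro exI[of _ "{}"]) auto
next
  case (Suc k)
  note V = Suc.prems(1)
  have Psym: "transpose P = P" and Ppos: "\<And>x. x \<noteq> 0 \<Longrightarrow> x \<bullet> (P *v x) > 0"
    using P by (auto simp: positive_definite_def)
  define r where "r y = (y \<bullet> (Q *v y)) / (y \<bullet> (P *v y))" for y
  let ?S = "sphere 0 1 \<inter> V"
  from Suc.prems have "dim V \<noteq> 0" by linarith
  then obtain v where v: "v \<in> V" "v \<noteq> 0" by (metis dim_eq_0 singleton_iff subsetI)
  have "compact ?S" by (intro compact_Int_closed closed_subspace V compact_sphere)
  moreover have "v /\<^sub>R norm v \<in> ?S" using v V by (auto simp: subspace_scale)
  moreover have "continuous_on ?S r" unfolding r_def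
    by (intro continuous_intros matrix_vector_mult_linear_continuous_on)
      (metis IntD1 Ppos less_irrefl norm_zero mem_sphere_0 zero_neq_one)
  ultimately obtain x where x: "x \<in> ?S" and xmax: "\<And>y. y \<in> ?S \<Longrightarrow> r y \<le> r x"
    using continuous_attains_sup[of ?S r] by blast
  have x0: "x \<noteq> 0" using x by auto
  define M where "M = r x *\<^sub>R P - Q"
  have Msym: "transpose M = M"
    using Psym Q by (auto simp: M_def transpose_def vec_eq_iff)
  have M: "y \<bullet> (M *v z) = r x * (y \<bullet> (P *v z)) - y \<bullet> (Q *v z)" for y z
    by (simp add: M_def matrix_vector_mult_diff_rdistrib inner_diff_right
        flip: scaleR_matrix_vector_assoc)
  have psd: "0 \<le> y \<bullet> (M *v y)" if "y \<in> V" for y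
  proof (cases "y = 0")
    case False
    have "r y = r (y /\<^sub>R norm y)"
      using False by (simp add: r_def matrix_vector_mult_scaleR)
    also have "\<dots> \<le> r x" using False that V by (intro xmax) (auto simp: subspace_scale)
    finally show ?thesis using Ppos[OF False]
      by (simp add: M r_def[of y] divide_le_eq)
  qed auto
  have nul: "x \<bullet> (M *v x) = 0" using Ppos[OF x0] by (simp add: M r_def)
  have orth: "r x * (x \<bullet> (P *v y)) = x \<bullet> (Q *v y)" if "y \<in> V" for y
    using semidefinite_null_orthogonal[OF V Msym psd _ nul that] x by (simp add: M)
  define V' where "V' = {y \<in> V. x \<bullet> (P *v y) = 0}"
  have V': "subspace V'"
    using V unfolding subspace_def V'_def
    by (auto simp: matrix_vector_right_distrib matrix_vector_mult_scaleR inner_add_right)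
  have "V \<subseteq> span (insert x V')"
  proof
    fix y assume y: "y \<in> V"
    \<comment> \<open>Subtracting the \<open>P\<close>-projection of \<open>y\<close> onto
      \<open>x\<close> lands in \<open>V'\<close>, so \<open>V'\<close> has at most one dimension
      less than \<open>V\<close>.\<close>
    define c where "c = (x \<bullet> (P *v y)) / (x \<bullet> (P *v x))"
    have "y - c *\<^sub>R x \<in> V'"
      using V y x Ppos[OF x0]
      by (auto simp: V'_def subspace_diff subspace_scale matrix_vector_mult_diff_distrib
          matrix_vector_mult_scaleR inner_diff_right c_def)
    then show "y \<in> span (insert x V')"
      by (auto simp: span_insert intro!: exI[of _ c] intro: span_base)
  qed
  then have "dim V \<le> dim (insert x V')" by (rule dim_mono)
  also have "\<dots> \<le> Suc (dim V')" by (simp add: dim_insert)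
  finally have "k \<le> dim V'" using Suc.prems by simp
  from Suc.IH[OF V' this] obtain B where B: "B \<subseteq> V'" "finite B" "card B = k" "0 \<notin> B"
    "pairwise (\<lambda>x y. x \<bullet> (P *v y) = 0 \<and> x \<bullet> (Q *v y) = 0) B" by blast
  have "x \<notin> B" using B(1) Ppos[OF x0] by (auto simp: V'_def)
  moreover have "x \<bullet> (P *v y) = 0 \<and> x \<bullet> (Q *v y) = 0" if "y \<in> B" for y
    using that B(1) orth[of y] by (auto simp: V'_def)
  ultimately show ?case
    using B x x0 symmetric_matrix_inner_swap[OF Psym] symmetric_matrix_inner_swap[OF Q]
    by (intro exI[of _ "insert x B"]) (auto simp: pairwise_insert V'_def)
qed

text \<open>The columns of \<open>S\<close> form a basis orthogonal for both forms, so both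
  congruences come out diagonal.\<close>

lemma simultaneous_diagonalization:
  fixes P Q :: "real ^ 'n ^ 'n"
  assumes P: "positive_definite P" and Q: "transpose Q = Q"
  obtains S :: "real ^ 'n ^ 'n" and d e
  where "det S \<noteq> 0" "\<And>i. d i > 0"
    "transpose S ** P ** S = (\<chi> i j. if i = j then d i else 0)"
    "transpose S ** Q ** S = (\<chi> i j. if i = j then e i else 0)"
proof -
  obtain B where B: "finite B" "card B = CARD('n)" "0 \<notin> B"
    "pairwise (\<lambda>x y. x \<bullet> (P *v y) = 0 \<and> x \<bullet> (Q *v y) = 0) B"
    using simultaneous_orthogonal_set[OF P Q subspace_UNIV, of "CARD('n)"] by auto
  then obtain f where f: "bij_betw f (UNIV :: 'n set) B"
    by (metis finite_class.finite_UNIV finite_same_card_bij)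
  define S :: "real ^ 'n ^ 'n" where "S = transpose (\<chi> i. f i)"
  have entry: "(transpose S ** M ** S) $ i $ j = f i \<bullet> (M *v f j)" for M :: "real ^ 'n ^ 'n" and i j
    by (simp add: S_def matrix_mul_assoc[symmetric])
      (simp add: matrix_matrix_mult_def matrix_vector_mult_def inner_vec_def transpose_def)
  have diag: "transpose S ** P ** S = (\<chi> i j. if i = j then f i \<bullet> (P *v f i) else 0)"
       "transpose S ** Q ** S = (\<chi> i j. if i = j then f i \<bullet> (Q *v f i) else 0)"
    using B(4) f
    by (simp_all add: vec_eq_iff[of _ "Cart_lambda _"] vec_eq_iff[of "Cart_lambda _ $ _"] vec_eq_iff[of "_ ** _"] 
        vec_eq_iff[of "(_ ** _) $ _"] entry pairwise_def bij_betw_def) (auto simp: inj_eq)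
  have pos: "f i \<bullet> (P *v f i) > 0" for i
  proof -
    have "f i \<noteq> 0" using B(3) f by (metis bij_betwE UNIV_I)
    then show ?thesis using P by (auto simp: positive_definite_def)
  qed
  \<comment> \<open>This determinant is \<open>det P\<close> times the square of
    \<open>det S\<close>, so its positivity alone shows that \<open>S\<close> is invertible.\<close>
  have "det (transpose S ** P ** S) = (\<Prod>i\<in>UNIV. f i \<bullet> (P *v f i))"
    unfolding diag by (subst det_diagonal) auto
  also have "\<dots> > 0" using pos by (intro prod_pos) auto
  finally have "det S \<noteq> 0" by (auto simp: det_mul)
  then show ?thesis using pos diag by (rule that)
qed

lemma det_diagonal_matrix:
  "det (\<chi> i j. if i = j then d i else 0 :: real ^ 'n ^ 'n) = (\<Prod>i\<in>UNIV. d i :: real)"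
  by (subst det_diagonal) auto

text \<open>Congruence with an invertible \<open>S\<close> multiplies the determinant by a positive
  square, which reduces the claim to a diagonal matrix with positive entries.\<close>

lemma positive_definite_det_pos:
  fixes P :: "real ^ 'n ^ 'n"
  assumes "positive_definite P"
  shows "det P > 0"
proof -
  obtain S :: "real ^ 'n ^ 'n" and d e where S: "det S \<noteq> 0" "\<And>i. d i > 0"
    "transpose S ** P ** S = (\<chi> i j. if i = j then d i else 0)"
    "transpose S ** P ** S = (\<chi> i j. if i = j then e i else 0)"
    using assms by (auto simp: positive_definite_def intro: simultaneous_diagonalization[OF assms])
  have "(det S)\<^sup>2 * det P = (\<Prod>i\<in>UNIV. d i)"
    unfolding det_diagonal_matrix[symmetric] S(3)[symmetric]
    by (simp add: det_mul power2_eq_square)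
  also have "\<dots> > 0" using S by (intro prod_pos) auto
  finally show ?thesis using S(1) by (simp add: zero_less_mult_iff)
qed

text \<open>In coordinates that diagonalise both matrices this is the inequality of arithmetic and
  geometric means for each pair \<open>d i\<close>, \<open>e i\<close>, strict for at least one pair
  since the matrices differ.\<close>

lemma det_midpoint_gt:
  fixes P Q :: "real ^ 'n ^ 'n"
  assumes P: "positive_definite P" and Q: "positive_definite Q"
    and "P \<noteq> Q" and det: "det P = det Q"
  shows "det P < det ((1/2) *\<^sub>R (P + Q))"
proof -
  obtain S :: "real ^ 'n ^ 'n" and d e where S: "det S \<noteq> 0" "\<And>i. d i > 0"
    "transpose S ** P ** S = (\<chi> i j. if i = j then d i else 0)"
    "transpose S ** Q ** S = (\<chi> i j. if i = j then e i else 0)"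
    using Q by (auto simp: positive_definite_def intro: simultaneous_diagonalization[OF P])
  define N where "N = (1/2) *\<^sub>R (P + Q)"
  have inv: "invertible S" "invertible (transpose S)"
    using S(1) by (auto simp: invertible_det_nz)
  have e: "e i > 0" for i
  proof -
    have "S *v axis i 1 \<noteq> 0"
      using inv(1) by (metis axis_eq_0_iff inj_matrix_vector_mult injD matrix_vector_mult_0_right zero_neq_one)
    then have "0 < (S *v axis i 1) \<bullet> (Q *v (S *v axis i 1))"
      using Q by (auto simp: positive_definite_def)
    also have "\<dots> = axis i 1 \<bullet> ((transpose S ** Q ** S) *v axis i 1)"
      by (simp only: inner_transpose_matrix flip: matrix_vector_mul_assoc)
    also have "\<dots> = e i" by (simp add: S(4) inner_axis' matrix_vector_mult_basis column_def)
    finally show ?thesis .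
  qed
  \<comment> \<open>The common factor by which the congruence changes all three
    determinants.\<close>
  define s where "s = (det S)\<^sup>2"
  have s: "s > 0" using S(1) by (simp add: s_def)
  have "transpose S ** N ** S = (1/2) *\<^sub>R (transpose S ** P ** S + transpose S ** Q ** S)"
    by (simp add: scaleR_add_right N_def matrix_scalar_ac matrix_add_ldistrib
        bounded_bilinear.add_left[OF bounded_bilinear_matrix_mult]
        flip: scalar_matrix_assoc)
  also have "\<dots> = (\<chi> i j. if i = j then (d i + e i) / 2 else 0)"
    by (auto simp: S vec_eq_iff)
  finally have N: "transpose S ** N ** S = (\<chi> i j. if i = j then (d i + e i) / 2 else 0)" .
  have dets: "s * det P = (\<Prod>i\<in>UNIV. d i)" "s * det Q = (\<Prod>i\<in>UNIV. e i)"
    "s * det N = (\<Prod>i\<in>UNIV. (d i + e i) / 2)"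
    unfolding det_diagonal_matrix[symmetric] S(3,4)[symmetric] N[symmetric] s_def
    by (simp_all add: det_mul power2_eq_square)
  have "\<exists>j. d j \<noteq> e j"
  \<comment> \<open>Equal diagonals would make the two congruences agree, and the invertible
    \<open>S\<close> cancels.\<close>
  proof (rule ccontr)
    assume "\<nexists>j. d j \<noteq> e j"
    then have "transpose S ** P ** S = transpose S ** Q ** S" using S by (simp cong: if_cong)
    then have "transpose S ** P = transpose S ** Q"
      by (metis inv(1) invertible_def matrix_mul_assoc matrix_mul_rid)
    then have "P = Q"
      by (metis inv(2) invertible_def matrix_mul_assoc matrix_mul_lid)
    with \<open>P \<noteq> Q\<close> show False ..
  qed
  then obtain j where j: "d j \<noteq> e j" ..
  \<comment> \<open>Squared means avoid square roots: equal determinants turn the square of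
    \<open>s * det P\<close> into the product of all \<open>d i * e i\<close>.\<close>
  let ?a = "\<lambda>i. ((d i + e i) / 2)\<^sup>2" and ?b = "\<lambda>i. d i * e i"
  have ab: "?a i - ?b i = ((d i - e i) / 2)\<^sup>2" for i
    by (simp add: power2_eq_square field_simps)
  have le: "?b i \<le> ?a i" for i using ab[of i] zero_le_power2[of "(d i - e i) / 2"] by linarith
  have "0 < ((d j - e j) / 2)\<^sup>2" using j by simp
  then have lt: "?b j < ?a j" using ab[of j] by linarith
  have bpos: "?b i > 0" for i using S(2) e by simp
  have "(s * det P)\<^sup>2 = (\<Prod>i\<in>UNIV. ?b i)"
    using dets(1,2) det by (simp add: prod.distrib power2_eq_square)
  also have "\<dots> = ?b j * (\<Prod>i\<in>UNIV - {j}. ?b i)" by (rule prod.remove) auto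
  also have "\<dots> < ?a j * (\<Prod>i\<in>UNIV - {j}. ?b i)"
    using lt bpos by (intro mult_strict_right_mono prod_pos) auto
  also have "\<dots> \<le> ?a j * (\<Prod>i\<in>UNIV - {j}. ?a i)"
    using le bpos by (intro mult_left_mono prod_mono) (auto intro: less_imp_le)
  also have "\<dots> = (\<Prod>i\<in>UNIV. ?a i)" by (rule prod.remove[symmetric]) auto
  also have "\<dots> = (s * det N)\<^sup>2" by (simp only: dets prod_power_distrib)
  finally have "(s * det P)\<^sup>2 < (s * det N)\<^sup>2" .
  moreover have "s * det N \<ge> 0" unfolding dets using S(2) e
    by (intro prod_nonneg) (auto simp: add_nonneg_nonneg less_imp_le)
  ultimately have "s * det P < s * det N" by (rule power2_less_imp_less)
  then show ?thesis using s by (simp add: N_def)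
qed

text \<open>A null vector of a semidefinite form lies in the kernel of its matrix, which is trivial
  when the determinant is nonzero. This makes maximisers of the determinant feasible.\<close>

lemma positive_definite_semidefinite_det:
  fixes M :: "real ^ 'n ^ 'n"
  assumes sym: "transpose M = M" and psd: "\<And>x. 0 \<le> x \<bullet> (M *v x)" and det: "det M \<noteq> 0"
  shows "positive_definite M"
  unfolding positive_definite_def
proof (intro conjI allI impI sym)
  fix x :: "real ^ 'n" assume "x \<noteq> 0"
  have "x \<bullet> (M *v x) \<noteq> 0"
  proof
    assume "x \<bullet> (M *v x) = 0"
    then have "x \<bullet> (M *v y) = 0" for y
      using semidefinite_null_orthogonal[OF subspace_UNIV sym, of x y] psd by simp
    then have "(M *v x) \<bullet> y = 0" for y
      using symmetric_matrix_inner_swap[OF sym, of x y] by (simp add: inner_commute)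
    then have "M *v x = 0" by (metis inner_eq_zero_iff)
    then show False
      using \<open>x \<noteq> 0\<close> det by (metis inj_matrix_vector_mult injD invertible_det_nz matrix_vector_mult_0_right)
  qed
  then show "x \<bullet> (M *v x) > 0" using psd[of x] by linarith
qed

section \<open>Matrix exponential\<close>

lemma matrix_power_scaleR: "matrix_power (t *\<^sub>R A) k = t ^ k *\<^sub>R matrix_power A k"
  by (induction k) (simp_all add: matrix_scalar_ac flip: scalar_matrix_assoc)

lemma matrix_power_commute: "A ** matrix_power A k = matrix_power A k ** A"
  by (induction k) (simp_all add: matrix_mul_assoc)

lemma transpose_matrix_power:
  fixes A :: "real ^ 'n ^ 'n"
  shows "transpose (matrix_power A k) = matrix_power (transpose A) k"
  by (induction k) (simp_all add: matrix_transpose_mul matrix_power_commute)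

text \<open>Matrix powers grow at most geometrically, with ratio \<open>K * norm A\<close> for a
  bilinear bound \<open>K\<close> of the matrix product, so a scalar exponential series
  dominates.\<close>

lemma summable_matrix_exp:
  fixes A :: "real ^ 'n ^ 'n"
  shows "summable (\<lambda>k. matrix_power A k /\<^sub>R fact k)"
proof -
  obtain K where K: "\<And>(X :: real ^ 'n ^ 'n) (Y :: real ^ 'n ^ 'n). norm (X ** Y) \<le> norm X * norm Y * K" "K \<ge> 0"
    using bounded_bilinear.nonneg_bounded[OF bounded_bilinear_matrix_mult] by blast
  define r where "r = K * norm A"
  have bound: "norm (matrix_power A k) \<le> norm (mat 1 :: real ^ 'n ^ 'n) * r ^ k" for k
  proof (induction k)
    case (Suc k)
    have "norm (matrix_power A (Suc k)) \<le> r * norm (matrix_power A k)"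
      using K(1)[of A "matrix_power A k"] by (simp add: r_def mult_ac)
    also have "\<dots> \<le> r * (norm (mat 1 :: real ^ 'n ^ 'n) * r ^ k)"
      using Suc K(2) by (intro mult_left_mono) (auto simp: r_def)
    finally show ?case by (simp add: mult_ac)
  qed simp
  have "norm (matrix_power A k /\<^sub>R fact k) \<le> norm (mat 1 :: real ^ 'n ^ 'n) * (inverse (fact k) * r ^ k)" for k
    using bound[of k] mult_left_mono[OF bound[of k], of "inverse (fact k)"] by (simp add: mult_ac)
  moreover have "summable (\<lambda>k. norm (mat 1 :: real ^ 'n ^ 'n) * (inverse (fact k) * r ^ k))"
    by (intro summable_mult summable_exp)
  ultimately show ?thesis by (rule summable_comparison_test'[rotated])
qed

lemma bounded_linear_transpose: "bounded_linear (transpose :: real ^ 'n ^ 'm \<Rightarrow> real ^ 'm ^ 'n)"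
  by (rule bounded_linearI') (auto simp: transpose_def vec_eq_iff)

lemma matrix_exp_transpose: "matrix_exp (transpose A) = transpose (matrix_exp A)"
  unfolding matrix_exp_def bounded_linear.suminf[OF bounded_linear_transpose summable_matrix_exp]
  by (simp add: transpose_matrix_power transpose_scalar)

lemma matrix_exp_commute: "A ** matrix_exp A = matrix_exp A ** A"
  unfolding matrix_exp_def
  by (simp add: bounded_linear.suminf[OF bounded_bilinear.bounded_linear_left[OF bounded_bilinear_matrix_mult] summable_matrix_exp]
     bounded_linear.suminf[OF bounded_bilinear.bounded_linear_right[OF bounded_bilinear_matrix_mult] summable_matrix_exp]
     matrix_scalar_ac matrix_power_commute flip: scalar_matrix_assoc)

lemma matrix_exp_zero: "matrix_exp 0 = mat 1"
proof -
  have "matrix_power (0 :: real ^ 'n ^ 'n) k = 0" if "k \<noteq> 0" for k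
    using that by (cases k) auto
  then show ?thesis
    unfolding matrix_exp_def by (subst suminf_finite[of "{0}"]) auto
qed

lemma matrix_exp_scaleR_commute: "A ** matrix_exp (t *\<^sub>R A) = matrix_exp (t *\<^sub>R A) ** A"
\<comment> \<open>Commutation with \<open>t *\<^sub>R A\<close> yields commutation with
  \<open>A\<close> after cancelling \<open>t\<close>, hence the separate case.\<close>
proof (cases "t = 0")
  case True
  then show ?thesis by (simp add: matrix_exp_zero)
next
  case False
  then show ?thesis
    using matrix_exp_commute[of "t *\<^sub>R A"] by (simp add: matrix_scalar_ac flip: scalar_matrix_assoc)
qed

lemma has_vector_derivative_matrix_componentwise:
  fixes f :: "real \<Rightarrow> real ^ 'n ^ 'm"
  assumes "\<And>i j. ((\<lambda>t. f t $ i $ j) has_real_derivative f' $ i $ j) (at t)"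
  shows "(f has_vector_derivative f') (at t)"
  unfolding has_vector_derivative_def
proof (subst has_derivative_componentwise_within, intro ballI)
  fix b :: "real ^ 'n ^ 'm" assume "b \<in> Basis"
  then obtain i j where b: "b = axis i (axis j 1)" by (auto simp: Basis_vec_def)
  show "((\<lambda>t. f t \<bullet> b) has_derivative (\<lambda>s. s *\<^sub>R f' \<bullet> b)) (at t)"
    using assms[of i j] by (simp add: b inner_axis has_field_derivative_def mult_commute_abs)
qed

text \<open>Each entry is an everywhere convergent real power series in \<open>t\<close>, so it may
  be differentiated term by term.\<close>

lemma matrix_exp_has_vector_derivative:
  fixes A :: "real ^ 'n ^ 'n"
  shows "((\<lambda>t. matrix_exp (t *\<^sub>R A)) has_vector_derivative A ** matrix_exp (t *\<^sub>R A)) (at t)"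
proof (rule has_vector_derivative_matrix_componentwise)
  fix i j :: 'n
  have lin: "bounded_linear (\<lambda>X :: real ^ 'n ^ 'n. X $ i $ j)"
    by (rule bounded_linearI') auto
  have lin': "bounded_linear (\<lambda>X :: real ^ 'n ^ 'n. (A ** X) $ i $ j)"
    by (rule bounded_linear_compose[OF lin bounded_bilinear.bounded_linear_right[OF bounded_bilinear_matrix_mult]])
  define c where "c k = matrix_power A k $ i $ j / fact k" for k
  have sm: "summable (\<lambda>k. c k * y ^ k)"
    and ex: "matrix_exp (y *\<^sub>R A) $ i $ j = (\<Sum>k. c k * y ^ k)" for y
    using bounded_linear.summable[OF lin summable_matrix_exp[of "y *\<^sub>R A"]]
      bounded_linear.suminf[OF lin summable_matrix_exp[of "y *\<^sub>R A"]]
    by (simp_all add: c_def matrix_exp_def matrix_power_scaleR field_simps)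
  \<comment> \<open>The k-th coefficient of \<open>diffs c\<close> is
    \<open>(k + 1) * c (k + 1)\<close>; the factor \<open>k + 1\<close> reduces
    \<open>(k + 1)!\<close> to \<open>k!\<close> and leaves an entry of \<open>A\<close> times its
    k-th power.\<close>
  have "(A ** matrix_exp (t *\<^sub>R A)) $ i $ j = (\<Sum>k. diffs c k * t ^ k)"
    unfolding matrix_exp_def bounded_linear.suminf[OF lin' summable_matrix_exp]
    by (simp add: c_def diffs_def matrix_power_scaleR matrix_scalar_ac field_simps del: of_nat_Suc flip: scalar_matrix_assoc)
  then show "((\<lambda>t. matrix_exp (t *\<^sub>R A) $ i $ j) has_real_derivative (A ** matrix_exp (t *\<^sub>R A)) $ i $ j) (at t)"
    using termdiffs_strong_converges_everywhere[OF sm] by (simp add: ex)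
qed

section \<open>Exponentially decaying functions\<close>

text \<open>The rate is hidden in the existential so that sums and products can be handled without
  tracking rates.\<close>

definition exp_decay :: "(real \<Rightarrow> 'a :: real_normed_vector) \<Rightarrow> bool" where
  "exp_decay f \<longleftrightarrow> (\<exists>C a. C \<ge> 0 \<and> a > 0 \<and> (\<forall>t\<ge>0. norm (f t) \<le> C * exp (- a * t)))"

lemma exp_decayI:
  assumes "C \<ge> 0" "a > 0" "\<And>t. t \<ge> 0 \<Longrightarrow> norm (f t) \<le> C * exp (- a * t)"
  shows "exp_decay f"
  unfolding exp_decay_def by (intro exI[of _ C] exI[of _ a] conjI allI impI assms)

text \<open>Lowering the rate weakens the bound, so it may be taken below any prescribed
  \<open>b\<close>. This lets a forcing term decay strictly slower than the homogeneous solution,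
  which rules out resonance.\<close>

lemma exp_decayE:
  assumes "exp_decay f" "b > 0"
  obtains C a where "C \<ge> 0" "0 < a" "a < b" "\<And>t. t \<ge> 0 \<Longrightarrow> norm (f t) \<le> C * exp (- a * t)"
proof -
  obtain C a where C: "C \<ge> 0" "a > 0" "\<And>t. t \<ge> 0 \<Longrightarrow> norm (f t) \<le> C * exp (- a * t)"
    using assms(1) by (auto simp: exp_decay_def)
  define a' where "a' = min a (b / 2)"
  have "norm (f t) \<le> C * exp (- a' * t)" if "t \<ge> 0" for t
  proof -
    have "a' * t \<le> a * t" using that by (intro mult_right_mono) (auto simp: a'_def)
    then have "C * exp (- a * t) \<le> C * exp (- a' * t)" using C by (intro mult_left_mono) auto
    then show ?thesis using C(3)[OF that] by linarith
  qed
  moreover have "0 < a'" "a' < b" using C assms(2) by (auto simp: a'_def)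
  ultimately show ?thesis using that C(1) by blast
qed

lemma exp_decay_mono:
  assumes "exp_decay g" "K \<ge> 0" "\<And>t. t \<ge> 0 \<Longrightarrow> norm (f t) \<le> K * norm (g t)"
  shows "exp_decay f"
proof -
  obtain C a where C: "C \<ge> 0" "a > 0" "\<And>t. t \<ge> 0 \<Longrightarrow> norm (g t) \<le> C * exp (- a * t)"
    using assms(1) by (auto simp: exp_decay_def)
  have "norm (f t) \<le> (K * C) * exp (- a * t)" if "t \<ge> 0" for t
    using assms(3)[OF that] mult_left_mono[OF C(3)[OF that] assms(2)] by (simp add: mult_ac)
  moreover have "K * C \<ge> 0" using C(1) assms(2) by simp
  ultimately show ?thesis using C(2) exp_decayI by blast
qed

lemma exp_decay_linear:
  assumes "bounded_linear h" "exp_decay f"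
  shows "exp_decay (\<lambda>t. h (f t))"
proof -
  obtain K where "K \<ge> 0" "\<And>x. norm (h x) \<le> norm x * K"
    using bounded_linear.nonneg_bounded[OF assms(1)] by blast
  then show ?thesis by (intro exp_decay_mono[OF assms(2), of K]) (simp_all add: mult.commute)
qed

lemma exp_decay_zero: "exp_decay (\<lambda>t. 0)"
  by (rule exp_decayI[of 0 1]) auto

lemma exp_decay_add:
  assumes "exp_decay f" "exp_decay g"
  shows "exp_decay (\<lambda>t. f t + g t)"
proof -
  obtain C a where C: "C \<ge> 0" "a > 0" "\<And>t. t \<ge> 0 \<Longrightarrow> norm (f t) \<le> C * exp (- a * t)"
    using assms(1) by (auto simp: exp_decay_def)
  obtain D b where D: "D \<ge> 0" "b > 0" "\<And>t. t \<ge> 0 \<Longrightarrow> norm (g t) \<le> D * exp (- b * t)"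
    using assms(2) by (auto simp: exp_decay_def)
  have "norm (f t + g t) \<le> (C + D) * exp (- min a b * t)" if t: "t \<ge> 0" for t
  proof -
    have "min a b * t \<le> a * t" "min a b * t \<le> b * t" using t by (intro mult_right_mono; simp)+
    then have "C * exp (- a * t) \<le> C * exp (- min a b * t)" "D * exp (- b * t) \<le> D * exp (- min a b * t)"
      using C(1) D(1) by (simp_all add: mult_left_mono)
    then show ?thesis
      using norm_triangle_ineq[of "f t" "g t"] C(3)[OF t] D(3)[OF t] unfolding distrib_right by linarith
  qed
  then show ?thesis using C(1,2) D(1,2) by (intro exp_decayI[of "C + D" "min a b"]) auto
qed

lemma exp_decay_sum:
  assumes "finite I" "\<And>i. i \<in> I \<Longrightarrow> exp_decay (f i)"
  shows "exp_decay (\<lambda>t. \<Sum>i\<in>I. f i t)"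
  using assms by (induction I rule: finite_induct) (simp_all add: exp_decay_zero exp_decay_add)

lemma exp_decay_componentwise:
  fixes f :: "real \<Rightarrow> 'a :: real_normed_vector ^ 'n"
  assumes "\<And>j. exp_decay (\<lambda>t. f t $ j)"
  shows "exp_decay f"
proof (rule exp_decay_mono)
  show "exp_decay (\<lambda>t. \<Sum>j\<in>UNIV. norm (f t $ j))"
  proof (intro exp_decay_sum)
    show "exp_decay (\<lambda>t. norm (f t $ j))" for j
      by (rule exp_decay_mono[OF assms[of j], of 1]) auto
  qed auto
  show "norm (f t) \<le> 1 * norm (\<Sum>j\<in>UNIV. norm (f t $ j))" for t
    unfolding norm_vec_def by (simp add: L2_set_le_sum sum_nonneg)
qed auto

text \<open>The product inherits the rate of the first factor, the second being bounded by its
  constant \<open>D\<close>.\<close>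

lemma exp_decay_bilinear:
  assumes h: "bounded_bilinear h" and "exp_decay f" "exp_decay g"
  shows "exp_decay (\<lambda>t. h (f t) (g t))"
proof -
  obtain D b where D: "D \<ge> 0" "b > 0" "\<And>t. t \<ge> 0 \<Longrightarrow> norm (g t) \<le> D * exp (- b * t)"
    using assms(3) by (auto simp: exp_decay_def)
  obtain K where K: "\<And>x y. norm (h x y) \<le> norm x * norm y * K" "K \<ge> 0"
    using bounded_bilinear.nonneg_bounded[OF h] by blast
  show ?thesis
  proof (rule exp_decay_mono[OF assms(2), of "D * K"])
    fix t :: real assume t: "t \<ge> 0"
    have "D * exp (- b * t) \<le> D" using D t by (intro mult_left_le) auto
    then have "norm (g t) \<le> D" using D(3)[OF t] by linarith
    then have "norm (f t) * norm (g t) * K \<le> norm (f t) * D * K"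
      using K(2) by (intro mult_right_mono mult_left_mono) auto
    then show "norm (h (f t) (g t)) \<le> D * K * norm (f t)"
      using K(1)[of "f t" "g t"] by (simp add: mult_ac)
  qed (use D K in auto)
qed

lemma exp_decay_tendsto_0:
  assumes "exp_decay f"
  shows "(\<lambda>k. f (real k)) \<longlonglongrightarrow> 0"
proof -
  obtain C a where C: "C \<ge> 0" "a > 0" "\<And>t. t \<ge> 0 \<Longrightarrow> norm (f t) \<le> C * exp (- a * t)"
    using assms by (auto simp: exp_decay_def)
  have bound: "norm (f (real k)) \<le> C * exp (- a) ^ k" for k
    using C(3)[of "real k"] by (simp add: exp_of_nat_mult[symmetric] mult.commute)
  have "(\<lambda>k. C * exp (- a) ^ k) \<longlonglongrightarrow> 0"
    using C(2) by (intro tendsto_mult_right_zero LIMSEQ_power_zero) auto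
  then show ?thesis by (rule Lim_null_comparison[OF always_eventually[OF allI[OF bound]]])
qed

text \<open>\<open>e\<^bsup>-zt\<^esup> u\<close> has derivative \<open>e\<^bsup>-zt\<^esup> w\<close>, which the mean value inequality compares with an
  exponential.\<close>

lemma exp_decay_linear_ode:
  fixes u w :: "real \<Rightarrow> complex"
  assumes u: "\<And>t. (u has_vector_derivative z * u t + w t) (at t)"
    and w: "exp_decay w" and z: "Re z < 0"
  shows "exp_decay u"
proof -
  define a where "a = - Re z"
  have a: "a > 0" using z by (simp add: a_def)
  obtain C b where C: "C \<ge> 0" "0 < b" "b < a" "\<And>t. t \<ge> 0 \<Longrightarrow> norm (w t) \<le> C * exp (- b * t)"
    using exp_decayE[OF w a] by metis
  define g where "g t = exp (t *\<^sub>R (- z)) * u t" for t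
  \<comment> \<open>An antiderivative of the bound \<open>C * exp ((a - b) * t)\<close> on the
    derivative of \<open>g\<close>; \<open>b < a\<close> makes its coefficient nonnegative.\<close>
  define \<phi> where "\<phi> t = C / (a - b) * exp ((a - b) * t)" for t
  have nexp: "norm (exp (t *\<^sub>R (- z))) = exp (a * t)" for t
    by (simp add: norm_exp_eq_Re a_def)
  have g': "(g has_vector_derivative exp (t *\<^sub>R (- z)) * w t) (at t)" for t
  proof -
    have "(g has_vector_derivative exp (t *\<^sub>R (- z)) * (z * u t + w t) + (exp (t *\<^sub>R (- z)) * (- z)) * u t) (at t)"
      unfolding g_def by (intro has_vector_derivative_mult exp_scaleR_has_vector_derivative_right u)
    then show ?thesis by (simp add: algebra_simps)
  qed
  have \<phi>': "(\<phi> has_vector_derivative C * exp ((a - b) * t)) (at t)" for t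
    unfolding \<phi>_def has_real_derivative_iff_has_vector_derivative[symmetric]
    using C by (auto intro!: derivative_eq_intros)
  \<comment> \<open>The mean value inequality is applied on a nondegenerate interval;
    \<open>t = 0\<close> is added at the end.\<close>
  have bound: "norm (u t) \<le> (norm (u 0) + C / (a - b)) * exp (- b * t)" if t: "t > 0" for t
  proof -
    have "norm (g t - g 0) \<le> \<phi> t - \<phi> 0"
    proof (rule differentiable_bound_general[OF t])
      show "continuous_on {0..t} g" "continuous_on {0..t} \<phi>"
        using g' \<phi>' by (auto intro!: continuous_at_imp_continuous_on has_vector_derivative_continuous)
      show "norm (exp (x *\<^sub>R (- z)) * w x) \<le> C * exp ((a - b) * x)" if "0 < x" for x
      proof -
        have "norm (exp (x *\<^sub>R (- z)) * w x) \<le> exp (a * x) * (C * exp (- b * x))"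
          unfolding norm_mult nexp using C(4)[of x] that by (intro mult_left_mono) auto
        also have "\<dots> = C * exp ((a - b) * x)" by (simp add: algebra_simps flip: exp_add)
        finally show ?thesis .
      qed
    qed (use g' \<phi>' in auto)
    also have "\<dots> \<le> \<phi> t" using C by (simp add: \<phi>_def)
    finally have "norm (g t) \<le> norm (u 0) + \<phi> t"
      using norm_triangle_sub[of "g t" "g 0"] by (simp add: g_def)
    then have "exp (a * t) * norm (u t) \<le> norm (u 0) + \<phi> t"
      unfolding g_def norm_mult nexp .
    then have "exp (- a * t) * (exp (a * t) * norm (u t)) \<le> exp (- a * t) * (norm (u 0) + \<phi> t)"
      by (rule mult_left_mono) auto
    then have "norm (u t) \<le> exp (- a * t) * (norm (u 0) + \<phi> t)"
      by (simp add: mult.assoc[symmetric] flip: exp_add)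
    also have "\<dots> = exp (- a * t) * norm (u 0) + C / (a - b) * exp (- b * t)"
    proof -
      have "exp (- a * t) * exp ((a - b) * t) = exp (- b * t)"
        by (simp add: algebra_simps flip: exp_add)
      then show ?thesis by (simp add: \<phi>_def distrib_left)
    qed
    also have "\<dots> \<le> exp (- b * t) * norm (u 0) + C / (a - b) * exp (- b * t)"
      using C t by (intro add_right_mono mult_right_mono) auto
    finally show ?thesis by (simp only: distrib_right mult.commute[of "exp _"])
  qed
  have "norm (u t) \<le> (norm (u 0) + C / (a - b)) * exp (- b * t)" if "t \<ge> 0" for t
    using bound[of t] that C by (cases "t = 0") auto
  moreover have "norm (u 0) + C / (a - b) \<ge> 0" using C by simp
  ultimately show ?thesis using C(2) exp_decayI by blast
qed

section \<open>Exponential decay for stable matrices\<close>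

lemma bounded_linear_complex_matrix_vec:
  "bounded_linear (\<lambda>X :: real ^ 'n ^ 'm. complex_matrix X *v v)"
  by (rule bounded_linearI')
    (simp_all add: complex_matrix_def matrix_vector_mult_def vec_eq_iff algebra_simps sum.distrib sum_distrib_left
      scaleR_sum_right scaleR_conv_of_real[where 'a = complex])

lemma complex_matrix_mult: "complex_matrix (A ** B) = complex_matrix A ** complex_matrix B"
  by (simp add: complex_matrix_def matrix_matrix_mult_def vec_eq_iff)

lemma complex_matrix_exp_commute:
  fixes A :: "real ^ 'n ^ 'n"
  shows "complex_matrix A *v (complex_matrix (matrix_exp (t *\<^sub>R A)) *v v)
    = complex_matrix (matrix_exp (t *\<^sub>R A)) *v (complex_matrix A *v v)"
  by (simp add: matrix_vector_mul_assoc matrix_exp_scaleR_commute flip: complex_matrix_mult)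

lemma complex_matrix_exp_shift_commute:
  fixes A :: "real ^ 'n ^ 'n"
  shows "complex_matrix (matrix_exp (t *\<^sub>R A)) *v (complex_matrix A *v v - z *s v)
    = complex_matrix A *v (complex_matrix (matrix_exp (t *\<^sub>R A)) *v v)
      - z *s (complex_matrix (matrix_exp (t *\<^sub>R A)) *v v)"
  by (simp add: complex_matrix_exp_commute matrix_vector_mult_diff_distrib vector_scalar_commute)

text \<open>Each coordinate of the trajectory of \<open>v\<close> solves a scalar linear equation
  with coefficient \<open>z\<close>, whose forcing term is a coordinate of the trajectory of
  \<open>A v - z v\<close>.\<close>

lemma exp_decay_shift_stable:
  fixes A :: "real ^ 'n ^ 'n"
  defines "u \<equiv> \<lambda>v t. complex_matrix (matrix_exp (t *\<^sub>R A)) *v v"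
  assumes z: "Re z < 0" and dec: "exp_decay (u (complex_matrix A *v v - z *s v))"
  shows "exp_decay (u v)"
proof (rule exp_decay_componentwise, rule exp_decay_linear_ode[OF _ _ z])
  fix j t
  show "exp_decay (\<lambda>t. u (complex_matrix A *v v - z *s v) t $ j)"
    by (rule exp_decay_linear[OF bounded_linear_vec_nth dec])
  have "((\<lambda>t. u v t $ j) has_vector_derivative (complex_matrix (A ** matrix_exp (t *\<^sub>R A)) *v v) $ j) (at t)"
    unfolding u_def
    by (intro bounded_linear.has_vector_derivative[OF bounded_linear_vec_nth]
        bounded_linear.has_vector_derivative[OF bounded_linear_complex_matrix_vec]
        matrix_exp_has_vector_derivative)
  also have "(complex_matrix (A ** matrix_exp (t *\<^sub>R A)) *v v) $ j
      = z * u v t $ j + u (complex_matrix A *v v - z *s v) t $ j"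
    unfolding u_def complex_matrix_exp_shift_commute
    by (simp add: complex_matrix_mult matrix_vector_mul_assoc)
  finally show "((\<lambda>t. u v t $ j) has_vector_derivative z * u v t $ j + u (complex_matrix A *v v - z *s v) t $ j) (at t)" .
qed

text \<open>Off the spectrum \<open>A - z\<close> is injective, hence bounded below in finite
  dimension. It commutes with the exponential, so up to a constant the trajectory of
  \<open>A v - z v\<close> dominates that of \<open>v\<close>.\<close>

lemma exp_decay_shift_regular:
  fixes A :: "real ^ 'n ^ 'n"
  defines "u \<equiv> \<lambda>v t. complex_matrix (matrix_exp (t *\<^sub>R A)) *v v"
  assumes z: "\<not> eigenvalue (complex_matrix A) z"
    and dec: "exp_decay (u (complex_matrix A *v v - z *s v))"
  shows "exp_decay (u v)"
proof -
  define L where "L x = complex_matrix A *v x - z *s x" for x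
  have lin: "linear L"
    unfolding L_def
    by (rule linearI) (simp_all add: matrix_vector_right_distrib vector_add_ldistrib
        matrix_vector_mult_def vec_eq_iff scaleR_sum_right sum.distrib algebra_simps)
  have "inj L"
    unfolding linear_injective_0[OF lin] using z by (auto simp: L_def eigenvalue_def)
  then obtain B where B: "B > 0" "\<And>x. B * norm x \<le> norm (L x)"
    using linear_inj_bounded_below_pos[OF lin] by blast
  show ?thesis
  proof (rule exp_decay_mono[OF dec, of "1 / B"])
    show "norm (u v t) \<le> 1 / B * norm (u (complex_matrix A *v v - z *s v) t)" for t
      using B(1) B(2)[of "u v t"] unfolding u_def complex_matrix_exp_shift_commute L_def
      by (simp add: field_simps)
  qed (use B in auto)
qed

section \<open>Polynomials in a matrix acting on a vector\<close>

text \<open>The vector \<open>p(T) v\<close> by Horner's scheme, so that only products of a matrix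
  with a vector occur.\<close>

definition poly_action :: "complex poly \<Rightarrow> complex ^ 'n ^ 'n \<Rightarrow> complex ^ 'n \<Rightarrow> complex ^ 'n" where
  "poly_action p T v = fold_coeffs (\<lambda>a w. a *s v + T *v w) p 0"

lemma poly_action_0 [simp]: "poly_action 0 T v = 0"
  by (simp add: poly_action_def)

lemma poly_action_pCons [simp]: "poly_action (pCons a p) T v = a *s v + T *v poly_action p T v"
  by (cases "a = 0 \<and> p = 0") (auto simp: poly_action_def)

text \<open>Division with remainder, \<open>p = (X - z) q + p(z)\<close>, applied to
  \<open>v\<close>. At a root \<open>z\<close> it turns an annihilator of \<open>v\<close> into one
  of \<open>T v - z v\<close>.\<close>

lemma poly_action_synthetic_div:
  "poly_action p T v = poly_action (synthetic_div p z) T (T *v v - z *s v) + poly p z *s v"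
proof (induction p)
  case (pCons a p)
  show ?case
    by (simp, subst pCons.IH)
      (simp add: matrix_vector_right_distrib vector_scalar_commute vector_sadd_rdistrib
        vector_ssub_ldistrib vector_smult_assoc algebra_simps)
qed simp

lemma poly_action_Poly:
  "poly_action (Poly (map c [0..<n])) T v = (\<Sum>k<n. c k *s (((*v) T ^^ k) v))"
proof (induction n arbitrary: c)
  case (Suc n)
  have "map c [0..<Suc n] = c 0 # map (\<lambda>k. c (Suc k)) [0..<n]"
    by (simp add: upt_conv_Cons del: upt_Suc flip: map_Suc_upt)
  then have "poly_action (Poly (map c [0..<Suc n])) T v
      = c 0 *s v + T *v (\<Sum>k<n. c (Suc k) *s (((*v) T ^^ k) v))"
    by (simp add: Suc.IH)
  also have "\<dots> = (\<Sum>k<Suc n. c k *s (((*v) T ^^ k) v))"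
    unfolding sum.lessThan_Suc_shift
    by (simp add: linear_sum[OF matrix_vector_mul_linear] vector_scalar_commute)
  finally show ?case .
qed simp

text \<open>One more iterate of \<open>v\<close> than the dimension forces a linear relation. The
  dimension is counted over the reals, so the relation has real coefficients.\<close>

lemma annihilating_polynomial:
  fixes T :: "complex ^ 'n ^ 'n"
  obtains p where "p \<noteq> 0" "poly_action p T v = 0"
proof -
  define w where "w k = ((*v) T ^^ k) v" for k
  define N where "N = Suc (DIM(complex ^ 'n))"
  obtain c :: "nat \<Rightarrow> real" where c: "\<exists>k<N. c k \<noteq> 0" "(\<Sum>k<N. c k *\<^sub>R w k) = 0"
  \<comment> \<open>Linear dependence concerns sets, so a repeated iterate is treated apart, with
    the relation \<open>w i - w j = 0\<close>.\<close>
  proof (cases "inj_on w {..<N}")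
    case True
    then have "card (w ` {..<N}) = N" by (simp add: card_image)
    then have "dependent (w ` {..<N})" by (intro dependent_biggerset) (auto simp: N_def)
    then obtain f where "\<exists>x\<in>w ` {..<N}. f x \<noteq> 0" "(\<Sum>x\<in>w ` {..<N}. f x *\<^sub>R x) = 0"
      by (auto simp: dependent_finite)
    with that[of "f \<circ> w"] True show ?thesis by (auto simp: sum.reindex)
  next
    case False
    then obtain i j where ij: "i < N" "j < N" "i \<noteq> j" "w i = w j" by (auto simp: inj_on_def)
    define c :: "nat \<Rightarrow> real" where "c k = (if k = i then 1 else 0) - (if k = j then 1 else 0)" for k
    have "(\<Sum>k<N. c k *\<^sub>R w k) = w i - w j"
      using ij(1,2) by (simp add: c_def scaleR_left_diff_distrib sum_subtractf if_distrib[of "\<lambda>x. x *\<^sub>R _"] cong: if_cong)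
    then show ?thesis using ij by (intro that[of c]) (auto simp: c_def intro!: exI[of _ i])
  qed
  define p where "p = Poly (map (\<lambda>k. complex_of_real (c k)) [0..<N])"
  obtain k where k: "k < N" "c k \<noteq> 0" using c(1) by blast
  have "coeff p k = of_real (c k)"
    using k by (simp add: p_def nth_default_def)
  then have "p \<noteq> 0" using k by auto
  moreover have "poly_action p T v = (\<Sum>k<N. c k *\<^sub>R w k)"
    unfolding p_def poly_action_Poly w_def
    by (intro sum.cong) (auto simp: vec_eq_iff scaleR_conv_of_real[where 'a = complex])
  ultimately show ?thesis using that c(2) by simp
qed

text \<open>Split off one root \<open>z\<close> of the annihilating polynomial at a time. If \<open>z\<close> is an eigenvalue,
  then \<open>Re z < 0\<close> and a scalar linear equation is solved; otherwise \<open>T - z\<close> is bounded below and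
  commutes with the exponential.\<close>

lemma exp_decay_poly_action:
  fixes A :: "real ^ 'n ^ 'n"
  defines "u \<equiv> \<lambda>v t. complex_matrix (matrix_exp (t *\<^sub>R A)) *v v"
  assumes stable: "stable_matrix A"
  shows "p \<noteq> 0 \<Longrightarrow> poly_action p (complex_matrix A) v = 0 \<Longrightarrow> exp_decay (u v)"
proof (induction "degree p" arbitrary: p v)
  case 0
  then obtain a where "p = [:a:]" "a \<noteq> 0" by (metis degree_eq_zeroE pCons_0_0)
  with 0 have "v = 0" by simp
  then have "u v = (\<lambda>t. 0)" by (simp add: u_def)
  then show ?case by (simp add: exp_decay_zero)
next
  case (Suc d)
  have "\<not> constant (poly p)" using Suc(2) by (simp add: constant_degree)
  then obtain z where z: "poly p z = 0" using fundamental_theorem_of_algebra by blast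
  have "exp_decay (u (complex_matrix A *v v - z *s v))"
  proof (rule Suc.hyps(1)[of "synthetic_div p z"])
    show "d = degree (synthetic_div p z)" using Suc(2) by (simp add: degree_synthetic_div)
    show "synthetic_div p z \<noteq> 0" using Suc(2) by (simp add: synthetic_div_eq_0_iff)
    show "poly_action (synthetic_div p z) (complex_matrix A) (complex_matrix A *v v - z *s v) = 0"
      using Suc.prems(2) z poly_action_synthetic_div[of p "complex_matrix A" v z] by simp
  qed
  then show ?case
    unfolding u_def using stable exp_decay_shift_stable exp_decay_shift_regular
    by (metis stable_matrix_def)
qed

text \<open>Column \<open>j\<close> is the trajectory of the j-th basis vector, for which there is
  an annihilating polynomial.\<close>

lemma exp_decay_matrix_exp:
  fixes A :: "real ^ 'n ^ 'n"
  assumes "stable_matrix A"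
  shows "exp_decay (\<lambda>t. matrix_exp (t *\<^sub>R A))"
proof (intro exp_decay_componentwise)
  fix i j
  obtain p where "p \<noteq> 0" "poly_action p (complex_matrix A) (axis j 1) = 0"
    by (rule annihilating_polynomial)
  then have "exp_decay (\<lambda>t. complex_matrix (matrix_exp (t *\<^sub>R A)) *v axis j 1)"
    by (rule exp_decay_poly_action[OF assms])
  then have "exp_decay (\<lambda>t. (complex_matrix (matrix_exp (t *\<^sub>R A)) *v axis j 1) $ i)"
    by (rule exp_decay_linear[OF bounded_linear_vec_nth])
  then show "exp_decay (\<lambda>t. matrix_exp (t *\<^sub>R A) $ i $ j)"
    by (rule exp_decay_mono[of _ 1]) (simp_all add: matrix_vector_mult_def axis_def complex_matrix_def
        if_distrib[of "\<lambda>x. _ * x"] cong: if_cong)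
qed

section \<open>The controllability Gramian\<close>

text \<open>\<open>F\<close> solves \<open>F' = A F + F A^T\<close> with \<open>F 0 = X\<close> and
  decays exponentially. Integrating over \<open>[0, k]\<close> and letting \<open>k\<close> grow
  leaves only \<open>- F 0\<close> on the right.\<close>

lemma lyapunov_integral:
  fixes A X :: "real ^ 'n ^ 'n"
  assumes "stable_matrix A"
  defines "F \<equiv> \<lambda>t. matrix_exp (t *\<^sub>R A) ** X ** matrix_exp (t *\<^sub>R transpose A)"
  shows "F integrable_on {0..}"
    and "A ** integral {0..} F + integral {0..} F ** transpose A = - X"
proof -
  note bil = bounded_bilinear_matrix_mult
  note left = bounded_bilinear.bounded_linear_left[OF bil]
  note right = bounded_bilinear.bounded_linear_right[OF bil]
  have exT: "matrix_exp (t *\<^sub>R transpose A) = transpose (matrix_exp (t *\<^sub>R A))" for t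
    by (simp add: transpose_scalar flip: matrix_exp_transpose)
  have E: "exp_decay (\<lambda>t. matrix_exp (t *\<^sub>R A))" by (rule exp_decay_matrix_exp[OF assms(1)])
  have decay: "exp_decay F"
    unfolding F_def exT
    by (intro exp_decay_bilinear[OF bil] exp_decay_linear[OF left] exp_decay_linear[OF bounded_linear_transpose] E)
  have deriv: "(F has_vector_derivative A ** F t + F t ** transpose A) (at t)" for t
  proof -
    have "(F has_vector_derivative (matrix_exp (t *\<^sub>R A) ** X) ** (transpose A ** matrix_exp (t *\<^sub>R transpose A))
        + ((A ** matrix_exp (t *\<^sub>R A)) ** X) ** matrix_exp (t *\<^sub>R transpose A)) (at t)"
      unfolding F_def
      by (intro bounded_bilinear.has_vector_derivative[OF bil] matrix_exp_has_vector_derivative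
          bounded_linear.has_vector_derivative[OF left])
    then show ?thesis
      by (simp add: F_def matrix_exp_scaleR_commute[of "transpose A"] matrix_mul_assoc add.commute)
  qed
  have cont: "continuous_on S F" for S
    using deriv by (auto intro!: continuous_at_imp_continuous_on has_vector_derivative_continuous)
  \<comment> \<open>Truncations of \<open>F\<close> to \<open>[0, k]\<close>: dominated convergence
    gives both integrability on the half-line and the limit of the integrals.\<close>
  define f where "f k t = (if t \<in> {0..real k} then F t else 0)" for k t
  obtain C a where C: "C \<ge> 0" "a > 0" "\<And>t. t \<ge> 0 \<Longrightarrow> norm (F t) \<le> C * exp (- a * t)"
    using decay by (auto simp: exp_decay_def)
  have Int: "{0..real k} \<inter> {0..} = {0..real k}" for k by auto
  have f_int: "f k integrable_on {0..}" for k
    unfolding f_def integrable_restrict_Int Int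
    by (intro integrable_continuous_interval cont)
  have h_int: "(\<lambda>t. C * exp (- a * t)) integrable_on {0..}"
    using integrable_on_exp_minus_to_infinity[OF C(2), of 0] by (rule integrable_on_mult_right)
  have le: "norm (f k t) \<le> C * exp (- a * t)" if "t \<in> {0..}" for k t
    using C(3)[of t] C(1) that by (auto simp: f_def)
  have conv: "(\<lambda>k. f k t) \<longlonglongrightarrow> F t" if "t \<in> {0..}" for t
  proof (rule tendsto_eventually)
    have "eventually (\<lambda>k. t \<le> real k) sequentially"
      using filterlim_real_sequentially by (simp add: filterlim_at_top)
    then show "eventually (\<lambda>k. f k t = F t) sequentially"
      by eventually_elim (use that in \<open>auto simp: f_def\<close>)
  qed
  show F_int: "F integrable_on {0..}"
    by (rule dominated_convergence(1)[OF f_int h_int le conv])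
  define J where "J k = integral {0..real k} F" for k
  have "(\<lambda>k. integral {0..} (f k)) \<longlonglongrightarrow> integral {0..} F"
    by (rule dominated_convergence(2)[OF f_int h_int le conv])
  moreover have "integral {0..} (f k) = J k" for k
    unfolding f_def integral_restrict_Int J_def Int ..
  ultimately have J: "J \<longlonglongrightarrow> integral {0..} F" by simp
  have J_eq: "A ** J k + J k ** transpose A = F (real k) - F 0" for k
  proof -
    have F_has: "(F has_integral J k) {0..real k}"
      unfolding J_def by (intro integrable_integral integrable_continuous_interval cont)
    have "((\<lambda>t. A ** F t + F t ** transpose A) has_integral A ** J k + J k ** transpose A) {0..real k}"
      using has_integral_linear[OF F_has right, of A] has_integral_linear[OF F_has left, of "transpose A"]
      by (intro has_integral_add) (simp_all add: o_def)
    moreover have "((\<lambda>t. A ** F t + F t ** transpose A) has_integral F (real k) - F 0) {0..real k}"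
      by (rule fundamental_theorem_of_calculus[OF _ has_vector_derivative_at_within[OF deriv]]) simp
    ultimately show ?thesis by (rule has_integral_unique)
  qed
  have "F 0 = X" by (simp add: F_def matrix_exp_zero)
  then have "(\<lambda>k. A ** J k + J k ** transpose A) \<longlonglongrightarrow> 0 - X"
    unfolding J_eq by (simp only:) (intro tendsto_diff exp_decay_tendsto_0[OF decay] tendsto_const)
  moreover have "(\<lambda>k. A ** J k + J k ** transpose A)
      \<longlonglongrightarrow> A ** integral {0..} F + integral {0..} F ** transpose A"
    by (intro tendsto_add bounded_linear.tendsto[OF right] bounded_linear.tendsto[OF left] J)
  ultimately show "A ** integral {0..} F + integral {0..} F ** transpose A = - X"
    unfolding diff_0[symmetric, of X] by (rule LIMSEQ_unique[rotated])
qed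

lemma columnvector_rowvector_axis:
  "(columnvector (axis i 1) :: real ^ 1 ^ 'n) ** rowvector (axis i 1)
    = (\<chi> a b. if a = i \<and> b = i then 1 else 0)"
  by (simp add: matrix_matrix_mult_def columnvector_def rowvector_def axis_def vec_eq_iff)

lemma W_single_lyapunov:
  fixes A :: "real ^ 'n ^ 'n"
  assumes "stable_matrix A"
  shows "A ** W_single A i + W_single A i ** transpose A = - (\<chi> a b. if a = i \<and> b = i then 1 else 0)"
  unfolding W_single_def columnvector_rowvector_axis by (rule lyapunov_integral(2)[OF assms])

lemma transpose_W_single:
  fixes A :: "real ^ 'n ^ 'n"
  assumes "stable_matrix A"
  shows "transpose (W_single A i) = W_single A i"
proof -
  have "transpose (\<chi> a b. if a = i \<and> b = i then 1 else 0 :: real ^ 'n ^ 'n)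
      = (\<chi> a b. if a = i \<and> b = i then 1 else 0)"
    by (auto simp: transpose_def vec_eq_iff)
  then show ?thesis
    unfolding W_single_def columnvector_rowvector_axis
    by (subst integral_linear[OF lyapunov_integral(1)[OF assms] bounded_linear_transpose, symmetric])
      (simp add: o_def matrix_transpose_mul matrix_mul_assoc transpose_scalar flip: matrix_exp_transpose)
qed

text \<open>With \<open>y\<close> the image of \<open>x\<close> under the transposed exponential,
  the form of the integrand is the square of \<open>y $ i\<close>; a bounded linear functional
  passes through the integral.\<close>

lemma W_single_semidefinite:
  fixes A :: "real ^ 'n ^ 'n"
  assumes "stable_matrix A"
  shows "0 \<le> x \<bullet> (W_single A i *v x)"
proof -
  let ?D = "\<chi> a b. if a = i \<and> b = i then 1 else 0 :: real ^ 'n ^ 'n"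
  let ?F = "\<lambda>t. matrix_exp (t *\<^sub>R A) ** ?D ** matrix_exp (t *\<^sub>R transpose A)"
  have lin: "bounded_linear (\<lambda>M :: real ^ 'n ^ 'n. x \<bullet> (M *v x))"
    by (rule bounded_linearI')
      (simp_all add: matrix_vector_mult_add_rdistrib inner_add_right flip: scaleR_matrix_vector_assoc)
  have D: "y \<bullet> (?D *v y) = (y $ i)\<^sup>2" for y :: "real ^ 'n"
  proof -
    have "?D *v y = axis i (y $ i)"
      by (auto simp: matrix_vector_mult_def axis_def vec_eq_iff if_distrib[of "\<lambda>z. z * _"] cong: if_cong)
    then show ?thesis by (simp add: inner_axis power2_eq_square)
  qed
  have pos: "0 \<le> x \<bullet> (?F t *v x)" for t
  proof -
    define y where "y = matrix_exp (t *\<^sub>R transpose A) *v x"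
    have E: "matrix_exp (t *\<^sub>R A) = transpose (matrix_exp (t *\<^sub>R transpose A))"
      by (simp add: transpose_scalar flip: matrix_exp_transpose)
    have "x \<bullet> (?F t *v x) = y \<bullet> (?D *v y)"
      unfolding E y_def by (simp only: inner_transpose_matrix flip: matrix_vector_mul_assoc)
    then show ?thesis by (simp add: D)
  qed
  have "x \<bullet> (W_single A i *v x) = integral {0..} (\<lambda>t. x \<bullet> (?F t *v x))"
    unfolding W_single_def columnvector_rowvector_axis
    using integral_linear[OF lyapunov_integral(1)[OF assms] lin, of ?D] by (simp add: o_def)
  also have "\<dots> \<ge> 0"
    using integrable_linear[OF lyapunov_integral(1)[OF assms] lin, of ?D] pos
    by (intro integral_nonneg) (simp_all add: o_def)
  finally show ?thesis .
qed

lemma W_con_lyapunov: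
  fixes A :: "real ^ 'n ^ 'n"
  assumes "stable_matrix A"
  shows "A ** W_con A p + W_con A p ** transpose A = - (\<chi> a b. if a = b then p $ a else 0)"
proof -
  note bil = bounded_bilinear_matrix_mult
  have "A ** W_con A p + W_con A p ** transpose A
      = (\<Sum>i\<in>UNIV. p $ i *\<^sub>R (A ** W_single A i + W_single A i ** transpose A))"
    by (simp add: W_con_def bounded_bilinear.sum_left[OF bil] bounded_bilinear.sum_right[OF bil]
        matrix_scalar_ac scaleR_add_right sum.distrib flip: scalar_matrix_assoc)
  also have "\<dots> = - (\<chi> a b. if a = b then p $ a else 0)"
    unfolding W_single_lyapunov[OF assms]
    by (auto simp: vec_eq_iff if_distrib[of "\<lambda>z. _ * z"] if_distrib[of uminus] sum_negf sum.delta' cong: if_cong)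
      (rule sum.neutral, auto)
  finally show ?thesis .
qed

lemma transpose_W_con:
  fixes A :: "real ^ 'n ^ 'n"
  assumes "stable_matrix A"
  shows "transpose (W_con A p) = W_con A p"
  by (simp add: W_con_def linear_sum[OF bounded_linear.linear[OF bounded_linear_transpose]]
      transpose_scalar transpose_W_single[OF assms])

lemma W_con_semidefinite:
  fixes A :: "real ^ 'n ^ 'n"
  assumes "stable_matrix A" "\<And>i. p $ i \<ge> 0"
  shows "0 \<le> x \<bullet> (W_con A p *v x)"
proof -
  have lin: "linear (\<lambda>M :: real ^ 'n ^ 'n. x \<bullet> (M *v x))"
    by (rule linearI)
      (simp_all add: matrix_vector_mult_add_rdistrib inner_add_right flip: scaleR_matrix_vector_assoc)
  have "x \<bullet> (W_con A p *v x) = (\<Sum>i\<in>UNIV. p $ i * (x \<bullet> (W_single A i *v x)))"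
    unfolding W_con_def linear_sum[OF lin] by (simp flip: scaleR_matrix_vector_assoc)
  also have "\<dots> \<ge> 0"
    using assms W_single_semidefinite by (intro sum_nonneg mult_nonneg_nonneg) auto
  finally show ?thesis .
qed

text \<open>The Lyapunov equation recovers the diagonal matrix of \<open>p\<close> from the
  Gramian.\<close>

lemma W_con_eq_iff:
  fixes A :: "real ^ 'n ^ 'n"
  assumes "stable_matrix A"
  shows "W_con A p = W_con A q \<longleftrightarrow> p = q"
proof
  assume "W_con A p = W_con A q"
  then have "(\<chi> a b. if a = b then p $ a else 0 :: real ^ 'n ^ 'n) = (\<chi> a b. if a = b then q $ a else 0)"
    using W_con_lyapunov[OF assms, of p] W_con_lyapunov[OF assms, of q] by simp
  then have "(\<chi> a b. if a = b then p $ a else 0 :: real ^ 'n ^ 'n) $ i $ i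
      = (\<chi> a b. if a = b then q $ a else 0 :: real ^ 'n ^ 'n) $ i $ i" for i
    by (rule arg_cong)
  then show "p = q" by (simp add: vec_eq_iff)
qed simp

text \<open>If the form vanishes at \<open>x\<close>, then \<open>x\<close> is in its radical and
  the left side of the Lyapunov equation has zero form at \<open>x\<close>. The right side gives
  minus the sum of \<open>p $ a\<close> times the square of \<open>x $ a\<close>, which forces
  \<open>x = 0\<close>.\<close>

lemma W_con_positive_definite:
  fixes A :: "real ^ 'n ^ 'n"
  assumes stable: "stable_matrix A" and p: "\<And>i. p $ i > 0"
  shows "positive_definite (W_con A p)"
  unfolding positive_definite_def
proof (intro conjI allI impI transpose_W_con stable)
  fix x :: "real ^ 'n" assume x: "x \<noteq> 0"
  note sym = transpose_W_con[OF stable, of p]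
  have psd: "0 \<le> y \<bullet> (W_con A p *v y)" for y
    using p by (intro W_con_semidefinite stable) (simp add: less_imp_le)
  have "x \<bullet> (W_con A p *v x) \<noteq> 0"
  proof
    assume "x \<bullet> (W_con A p *v x) = 0"
    then have nul: "x \<bullet> (W_con A p *v y) = 0" for y
      using semidefinite_null_orthogonal[OF subspace_UNIV sym psd, of x y] by simp
    \<comment> \<open>Symmetry and transposition turn the first Lyapunov term into the second, which
      \<open>nul\<close> annihilates.\<close>
    have "x \<bullet> (A *v (W_con A p *v x)) = x \<bullet> (W_con A p *v (transpose A *v x))"
      unfolding symmetric_matrix_inner_swap[OF sym, of x]
      using inner_transpose_matrix[of x "transpose A" "W_con A p *v x"] by (simp only: transpose_transpose)
    then have "x \<bullet> ((A ** W_con A p + W_con A p ** transpose A) *v x) = 0"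
      by (simp only: matrix_vector_mult_add_rdistrib inner_add_right nul add_0_left flip: matrix_vector_mul_assoc)
    moreover have "(- (\<chi> a b. if a = b then p $ a else 0)) *v x = - (\<chi> a. p $ a * x $ a)"
      by (simp add: matrix_vector_mult_def vec_eq_iff sum_negf if_distrib[of "\<lambda>z. z * _"] cong: if_cong)
    ultimately have "(\<Sum>a\<in>UNIV. x $ a * (p $ a * x $ a)) = 0"
      unfolding W_con_lyapunov[OF stable]
      by (simp add: inner_vec_def sum_negf)
    moreover have "x $ a * (p $ a * x $ a) \<ge> 0" for a
      using p[of a] by (simp add: mult.left_commute[of "x $ a"] less_imp_le)
    ultimately have "x $ a * (p $ a * x $ a) = 0" for a
      by (simp add: sum_nonneg_eq_0_iff)
    then have "x $ a = 0" for a using p[of a] by (metis mult_eq_0_iff less_irrefl)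
    with x show False by (simp add: vec_eq_iff)
  qed
  with psd[of x] show "x \<bullet> (W_con A p *v x) > 0" by linarith
qed

section \<open>Existence and uniqueness of the optimum\<close>

lemma compact_Delta: "compact (Delta :: (real ^ 'n) set)"
  unfolding compact_eq_bounded_closed
proof
  have "p $ i \<le> 1" if "p \<in> Delta" for p :: "real ^ 'n" and i
    using that member_le_sum[of i UNIV "($) p"] by (auto simp: Delta_def)
  then have "(Delta :: (real ^ 'n) set) \<subseteq> cbox 0 1"
    by (auto simp: mem_box_cart Delta_def)
  then show "bounded (Delta :: (real ^ 'n) set)" by (rule bounded_subset[OF bounded_cbox])
  have "Delta = {p :: real ^ 'n. (\<Sum>i\<in>UNIV. p $ i) = 1} \<inter> (\<Inter>i. {p. 0 \<le> p $ i})"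
    by (auto simp: Delta_def)
  also have "closed \<dots>"
    by (intro closed_Int closed_INT ballI closed_Collect_eq closed_Collect_le continuous_intros)
  finally show "closed (Delta :: (real ^ 'n) set)" .
qed

lemma continuous_on_det_W_con: "continuous_on S (\<lambda>p. det (W_con A p))"
  unfolding det_def W_con_def by (simp, intro continuous_intros)

theorem theorem2:
  fixes A :: "real ^ 'n ^ 'n"
  assumes "stable_matrix A"
  shows "\<exists>!p. p \<in> feasible A \<and> (\<forall>q\<in>feasible A. objective A p \<le> objective A q)"
proof -
  \<comment> \<open>The barycentre has a positive determinant, so the maximum over the simplex is
    positive.\<close>
  define u :: "real ^ 'n" where "u = (\<chi> i. 1 / CARD('n))"
  have u: "u \<in> Delta" "positive_definite (W_con A u)"
    by (auto simp: u_def Delta_def intro!: W_con_positive_definite[OF assms])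
  \<comment> \<open>The maximum is taken over all of the compact \<open>Delta\<close>, as
    \<open>feasible A\<close> need not be closed.\<close>
  then obtain p where p: "p \<in> Delta" "\<And>q. q \<in> Delta \<Longrightarrow> det (W_con A q) \<le> det (W_con A p)"
    using continuous_attains_sup[OF compact_Delta _ continuous_on_det_W_con] by blast
  have det_pos: "det (W_con A p) > 0"
    using p(2)[OF u(1)] positive_definite_det_pos[OF u(2)] by linarith
  have "positive_definite (W_con A p)"
    using p(1) det_pos by (intro positive_definite_semidefinite_det transpose_W_con[OF assms]
        W_con_semidefinite[OF assms]) (auto simp: Delta_def)
  then have feas: "p \<in> feasible A" using p(1) by (simp add: feasible_def X_set_def)
  have opt: "objective A p \<le> objective A q" if "q \<in> feasible A" for q
    using p(2)[of q] that positive_definite_det_pos[of "W_con A q"] det_pos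
    by (simp add: objective_def feasible_def X_set_def)
  show ?thesis
  proof (rule ex1I[of _ p])
    show "p \<in> feasible A \<and> (\<forall>q\<in>feasible A. objective A p \<le> objective A q)"
      using feas opt by blast
  next
    fix q assume q: "q \<in> feasible A \<and> (\<forall>r\<in>feasible A. objective A q \<le> objective A r)"
    then have q_pd: "positive_definite (W_con A q)" and q_Delta: "q \<in> Delta"
      by (auto simp: feasible_def X_set_def)
    have "objective A q = objective A p" using q feas opt by (meson order_antisym)
    then have det_eq: "det (W_con A p) = det (W_con A q)"
      using det_pos positive_definite_det_pos[OF q_pd] by (simp add: objective_def)
    show "q = p"
    proof (rule ccontr)
      assume "q \<noteq> p"
      then have "W_con A p \<noteq> W_con A q" by (simp add: W_con_eq_iff[OF assms])
      then have "det (W_con A p) < det ((1/2) *\<^sub>R (W_con A p + W_con A q))"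
        by (intro det_midpoint_gt \<open>positive_definite (W_con A p)\<close> q_pd det_eq)
      \<comment> \<open>\<open>W_con A\<close> is linear and \<open>Delta\<close> convex, so the
        midpoint competes with the maximiser \<open>p\<close>.\<close>
      also have "(1/2) *\<^sub>R (W_con A p + W_con A q) = W_con A ((1/2) *\<^sub>R (p + q))"
        by (simp add: W_con_def scaleR_sum_right scaleR_add_left scaleR_add_right sum.distrib add_divide_distrib)
      also have "det \<dots> \<le> det (W_con A p)"
      proof (rule p(2))
        show "(1/2) *\<^sub>R (p + q) \<in> Delta"
          using p(1) q_Delta by (auto simp: Delta_def sum.distrib simp flip: sum_divide_distrib)
      qed
      finally show False by simp
    qed
  qed
qed

end
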